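(* Let $F$ be a probability distribution function on $[0,1]$ with right edge $b=b(F)<1$, let $\alpha_c<\alpha<\infty$, and set $n=\lfloor\alpha m\rfloor$, $H=H(m,n,F)$. Then $P(H=m)$ converges to $1$ exponentially fast as $m\to\infty$ (and therefore $P(H=m \text{ for all sufficiently large } m)=1$).
   Context: Setup. $p$ denotes a generic random variable with distribution function $F(s)=P(p\le s)$ on $[0,1]$, and $\langle\,\cdot\,\rangle$ denotes integration (expectation) with respect to $dF$. Put $b=b(F)=\min\{s: F(s)=1\}$. The environment $p_1,p_2,\dots$ is i.i.d. with distribution $F$. Given the environment, $(\varepsilon_{i,j})_{i,j\ge1}$ are independent Bernoulli variables with $P(\varepsilon_{i,j}=1)=p_j$ (row index $i$ counted from the bottom, column index $j$ from the left); all matrices are built from this one infinite array on one probability space, and $P$ averages over both the environment and the Bernoulli variables. For $m,n\ge 1$, $A=A(F)$ is the $m\times n$ matrix $(\varepsilon_{i,j})_{1\le i\le m,1\le j\le n}$. An increasing path in $A$ is a sequence of positions whose entries are all 1, whose column indices are nondecreasing and whose row indices are strictly increasing. $H=H(m,n,F)$ is the length (number of 1's) of a longest increasing path in $A$ (so $H\le m$). Critical value: $\alpha_c=\left\langle\frac{p}{1-p}\right\rangle^{-1}$ (with $1/0=\infty$). *)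

theory Defs
  imports "HOL-Probability.Probability"
begin

definition unit_distribution_function :: "(real \<Rightarrow> real) \<Rightarrow> bool" where
  "unit_distribution_function F \<longleftrightarrow>
     mono F \<and> (\<forall>s. continuous (at_right s) F) \<and> (\<forall>s<0. F s = 0) \<and> (\<forall>s\<ge>1. F s = 1)"

text \<open>The minimum of the set of all s with F s = 1 is attained, by right-continuity.\<close>

definition right_edge :: "(real \<Rightarrow> real) \<Rightarrow> real" where
  "right_edge F = (LEAST s. F s = 1)"

text \<open>
  Division and inverse are those of \<^typ>\<open>ennreal\<close>, so the integrand is infinite at s = 1,
  and the critical value is infinite if the integral is 0 and 0 if the integral is infinite.
\<close>

definition critical_value :: "(real \<Rightarrow> real) \<Rightarrow> ennreal" where
  "critical_value F = inverse (\<integral>\<^sup>+s. ennreal s / ennreal (1 - s) \<partial>interval_measure F)"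

text \<open>
  Positions are pairs (row, column), both counted from 1; a matrix of zeros and ones is
  given by the predicate telling where the entry is 1.
\<close>

definition increasing_path ::
    "(nat \<Rightarrow> nat \<Rightarrow> bool) \<Rightarrow> nat \<Rightarrow> nat \<Rightarrow> (nat \<times> nat) list \<Rightarrow> bool" where
  "increasing_path A m n xs \<longleftrightarrow>
     (\<forall>(i, j)\<in>set xs. i \<in> {1..m} \<and> j \<in> {1..n} \<and> A i j) \<and>
     sorted_wrt (\<lambda>(i, j) (i', j'). i < i' \<and> j \<le> j') xs"

definition longest_increasing_path :: "(nat \<Rightarrow> nat \<Rightarrow> bool) \<Rightarrow> nat \<Rightarrow> nat \<Rightarrow> nat" where
  "longest_increasing_path A m n = Max (length ` {xs. increasing_path A m n xs})"

text \<open>The maximum is taken over a finite nonempty set.\<close>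

lemma increasing_path_Nil: "increasing_path A m n []"
  by (simp add: increasing_path_def)

lemma length_increasing_path_le:
  assumes "increasing_path A m n xs"
  shows "length xs \<le> m"
proof -
  have "sorted_wrt (<) (map fst xs)"
    unfolding sorted_wrt_map
    by (rule sorted_wrt_mono_rel[of xs "\<lambda>(i, j) (i', j'). i < i' \<and> j \<le> j'"])
      (use assms in \<open>auto simp: increasing_path_def\<close>)
  then have "distinct (map fst xs)"
    by (simp add: strict_sorted_iff)
  then have "length xs = card (fst ` set xs)"
    by (metis distinct_card length_map list.set_map)
  also have "\<dots> \<le> card {1..m}"
    by (rule card_mono) (use assms in \<open>auto simp: increasing_path_def\<close>)
  finally show ?thesis by simp
qed

lemma finite_length_increasing_paths: "finite (length ` {xs. increasing_path A m n xs})"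
  by (rule finite_subset[of _ "{..m}"]) (auto dest: length_increasing_path_le)

text \<open>The sigma-algebra generated by the environment p 1, p 2, ...\<close>

definition environment_algebra :: "'a measure \<Rightarrow> (nat \<Rightarrow> 'a \<Rightarrow> real) \<Rightarrow> 'a measure" where
  "environment_algebra M p =
     vimage_algebra (space M) (\<lambda>\<omega>. \<lambda>j\<in>{1..}. p j \<omega>) (\<Pi>\<^sub>M j\<in>{1..}. borel)"

text \<open>
  The last assumption says that, conditionally on the environment, the entries
  \<open>\<epsilon> i j\<close> are independent Bernoulli variables with parameters \<open>p j\<close>: it gives all
  their finite-dimensional conditional distributions.
\<close>

locale random_environment_matrix = prob_space M
  for M :: "'a measure" and F :: "real \<Rightarrow> real"
    and p :: "nat \<Rightarrow> 'a \<Rightarrow> real" and \<epsilon> :: "nat \<Rightarrow> nat \<Rightarrow> 'a \<Rightarrow> bool" +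
  assumes environment_indep: "indep_vars (\<lambda>_. borel) p {1..}"
    and environment_cdf: "\<And>j. j \<ge> 1 \<Longrightarrow> cdf (distr M borel (p j)) = F"
    and entry_measurable:
      "\<And>i j. i \<ge> 1 \<Longrightarrow> j \<ge> 1 \<Longrightarrow> \<epsilon> i j \<in> measurable M (count_space UNIV)"
    and entry_conditional_law:
      "\<And>S e. finite S \<Longrightarrow> S \<subseteq> {1..} \<times> {1..} \<Longrightarrow>
        AE \<omega> in M.
          real_cond_exp M (environment_algebra M p)
            (indicat_real {\<omega>\<in>space M. \<forall>(i, j)\<in>S. \<epsilon> i j \<omega> = e i j}) \<omega> =
          (\<Prod>(i, j)\<in>S. pmf (bernoulli_pmf (p j \<omega>)) (e i j))"

end

theory Submission
  imports Defs
begin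

text \<open>
  Since an increasing path uses each row at most once, \<open>H = m\<close> means that some path visits
  every row. Such a path may be taken to be greedy: at row \<open>r\<close> and column \<open>j\<close> it climbs
  if the entry of row \<open>r + 1\<close> in column \<open>j\<close> is 1, and moves one column to the right
  otherwise (\<open>ascends_climb\<close>, \<open>ascends_move_right\<close>). Every entry is inspected at most
  once, so, given the environment, the numbers of steps climbed in the successive columns are
  independent and geometric with mean \<open>p / (1 - p)\<close>; averaged over the environment they are
  i.i.d. with mean \<open>1 / \<alpha>\<^sub>c\<close>. The ascent succeeds iff the first \<open>n\<close> of them
  add up to at least \<open>m\<close>, and \<open>n / \<alpha>\<^sub>c\<close> exceeds \<open>m\<close> by a constant factor, so
  failure is a lower large deviation of a sum of nonnegative i.i.d. variables and has
  exponentially small probability by Chernoff's bound.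

  The proof carries out Chernoff's bound without constructing the geometric variables. For
  \<open>0 < x < 1\<close> the generating function of the steps climbed in a column with parameter \<open>u\<close>
  is \<open>g(u) = (1 - u) / (1 - x u)\<close>. It satisfies \<open>g(u) = u x g(u) + (1 - u)\<close>, which is
  exactly what makes \<open>x\<^sup>r\<close> times the product of \<open>g\<close> over the remaining columns a
  martingale along the ascent. By induction along the ascent, the probability of getting stuck
  is at most \<open>x\<close> to the power \<open>-m\<close> times the expected product of the \<open>g(p k)\<close> over
  \<open>k = 1..n\<close> (\<open>prob_match_and_stuck_le\<close>), and independence of the environment turns
  that expectation into the \<open>n\<close>-th power of \<open>\<gamma>(x) = \<langle>g(p)\<rangle>\<close>
  (\<open>prob_stuck_le\<close>).

  It remains to choose \<open>x\<close>. As \<open>1 - \<gamma>(x) = (1 - x) \<langle>p / (1 - x p)\<rangle>\<close> and the last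
  average increases to \<open>1 / \<alpha>\<^sub>c > 1 / \<alpha>\<close> as \<open>x\<close> tends to 1, the number
  \<open>\<gamma>(x)\<close> to the power \<open>\<alpha>\<close> is smaller than \<open>x\<close> for \<open>x\<close> close to 1, so the bound
  decays exponentially in \<open>m\<close> (\<open>exists_exponential_chernoff_bound\<close>). The almost sure
  statement follows by the Borel-Cantelli lemma.
\<close>

section \<open>The greedy ascent\<close>

text \<open>
  The state \<open>(r, j)\<close> means that the rows up to \<open>r\<close> have been climbed and that column \<open>j\<close>
  is the first one still usable; the missing \<open>m - r\<close> rows all have to be visited.
\<close>

definition ascends :: "(nat \<Rightarrow> nat \<Rightarrow> bool) \<Rightarrow> nat \<Rightarrow> nat \<Rightarrow> nat \<Rightarrow> nat \<Rightarrow> bool" where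
  "ascends A m n r j \<longleftrightarrow>
     (\<exists>xs. increasing_path A m n xs \<and> length xs = m - r \<and> (\<forall>(i, k)\<in>set xs. r < i \<and> j \<le> k))"

lemma length_increasing_path_above_row:
  assumes "increasing_path A m n xs" and "\<forall>(i, k)\<in>set xs. r < i"
  shows "length xs \<le> m - r"
  using assms
proof (induction xs arbitrary: r)
  case (Cons x xs)
  obtain i k where x: "x = (i, k)" by (cases x)
  have "length xs \<le> m - i"
    using Cons.prems by (intro Cons.IH) (auto simp: increasing_path_def x)
  moreover have "r < i" "i \<le> m"
    using Cons.prems by (auto simp: increasing_path_def x)
  ultimately show ?case by simp
qed simp

lemma longest_increasing_path_eq_iff_ascends:
  "longest_increasing_path A m n = m \<longleftrightarrow> ascends A m n 0 1"
proof -
  let ?L = "length ` {xs. increasing_path A m n xs}"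
  have "?L \<noteq> {}" using increasing_path_Nil by blast
  moreover have "\<And>l. l \<in> ?L \<Longrightarrow> l \<le> m" by (auto dest: length_increasing_path_le)
  ultimately have "longest_increasing_path A m n = m \<longleftrightarrow> m \<in> ?L"
    unfolding longest_increasing_path_def
    by (metis (no_types, lifting) Max_eqI Max_in finite_length_increasing_paths)
  also have "\<dots> \<longleftrightarrow> ascends A m n 0 1"
    unfolding ascends_def by (fastforce simp: increasing_path_def)
  finally show ?thesis .
qed

lemma ascends_top_row: "ascends A m n m j"
  unfolding ascends_def by (intro exI[of _ "[]"]) (simp add: increasing_path_Nil)

lemma not_ascends_beyond_last_column:
  assumes "r < m" and "n < j"
  shows "\<not> ascends A m n r j"
proof
  assume "ascends A m n r j"
  then obtain xs where "increasing_path A m n xs" "length xs = m - r" "\<forall>(i, k)\<in>set xs. j \<le> k"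
    unfolding ascends_def by auto
  with assms show False
    by (cases xs) (auto simp: increasing_path_def)
qed

text \<open>
  Climbing as soon as possible loses nothing: the first step of any path from \<open>(r, j)\<close> may be
  exchanged for the entry at \<open>(r + 1, j)\<close>, which lies weakly to its left.
\<close>

lemma ascends_climb:
  assumes "r < m" and "1 \<le> j" "j \<le> n" and "A (Suc r) j"
  shows "ascends A m n r j \<longleftrightarrow> ascends A m n (Suc r) j"
proof
  assume "ascends A m n r j"
  then obtain xs where xs: "increasing_path A m n xs" "length xs = m - r"
      "\<forall>(i, k)\<in>set xs. r < i \<and> j \<le> k"
    unfolding ascends_def by auto
  then obtain i k ys where "xs = (i, k) # ys"
    using \<open>r < m\<close> by (cases xs) auto
  with xs have "increasing_path A m n ys" "length ys = m - Suc r"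
      "\<forall>(i, k)\<in>set ys. Suc r < i \<and> j \<le> k"
    by (auto simp: increasing_path_def)
  then show "ascends A m n (Suc r) j"
    unfolding ascends_def by blast
next
  assume "ascends A m n (Suc r) j"
  then obtain ys where "increasing_path A m n ys" "length ys = m - Suc r"
      "\<forall>(i, k)\<in>set ys. Suc r < i \<and> j \<le> k"
    unfolding ascends_def by auto
  with assms show "ascends A m n r j"
    unfolding ascends_def
    by (intro exI[of _ "(Suc r, j) # ys"]) (auto simp: increasing_path_def)
qed

text \<open>
  A path from \<open>(r, j)\<close> has no row to spare, so its first position lies in row \<open>r + 1\<close>.
  If the entry in column \<open>j\<close> is 0, that position and all later ones lie further right.
\<close>

lemma ascends_move_right:
  assumes "r < m" and "\<not> A (Suc r) j"
  shows "ascends A m n r j \<longleftrightarrow> ascends A m n r (Suc j)"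
proof
  assume "ascends A m n r j"
  then obtain xs where xs: "increasing_path A m n xs" "length xs = m - r"
      "\<forall>(i, k)\<in>set xs. r < i \<and> j \<le> k"
    unfolding ascends_def by auto
  then obtain i k ys where Cons: "xs = (i, k) # ys"
    using \<open>r < m\<close> by (cases xs) auto
  have "length ys \<le> m - i"
    using xs(1) by (intro length_increasing_path_above_row[of A m n])
      (auto simp: Cons increasing_path_def)
  moreover have "r < i" "i \<le> m"
    using xs by (auto simp: Cons increasing_path_def)
  ultimately have "i = Suc r"
    using xs(2) by (simp add: Cons)
  then have "k \<noteq> j"
    using xs(1) assms(2) by (auto simp: Cons increasing_path_def)
  then have "Suc j \<le> k"
    using xs(3) by (auto simp: Cons)
  then have "\<forall>(i, k)\<in>set xs. r < i \<and> Suc j \<le> k"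
    using xs by (fastforce simp: Cons increasing_path_def)
  with xs show "ascends A m n r (Suc j)"
    unfolding ascends_def by blast
next
  assume "ascends A m n r (Suc j)"
  then show "ascends A m n r j"
    unfolding ascends_def by fastforce
qed

lemma ascends_step:
  assumes "r < m" and "1 \<le> j" "j \<le> n"
  shows "ascends A m n r j \<longleftrightarrow>
    (if A (Suc r) j then ascends A m n (Suc r) j else ascends A m n r (Suc j))"
  using ascends_climb[OF assms] ascends_move_right[OF assms(1)] by simp

section \<open>The number of steps climbed in one column\<close>

text \<open>
  The Bernoulli distribution with a parameter outside \<open>[0, 1]\<close> is the one with the parameter
  moved to the nearest endpoint. Working with this clipped parameter makes the estimates below
  hold at every sample point instead of almost everywhere.
\<close>

definition clip :: "real \<Rightarrow> real" where
  "clip s = min 1 (max 0 s)"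

lemma clip_bounds [simp]: "0 \<le> clip s" "clip s \<le> 1"
  by (auto simp: clip_def)

lemma borel_measurable_clip [measurable]: "clip \<in> borel_measurable borel"
  unfolding clip_def[abs_def] by measurable

lemma pmf_bernoulli_eq_clip: "pmf (bernoulli_pmf s) b = (if b then clip s else 1 - clip s)"
  by (simp add: clip_def bernoulli_pmf.rep_eq)

text \<open>
  The expectation of \<open>x\<close> to the power \<open>G\<close>, where \<open>G\<close> is geometric with
  \<open>P(G \<ge> k) = u\<^sup>k\<close>. For \<open>u = 1\<close> and \<open>x < 1\<close> it is 0, in accordance with
  \<open>G\<close> being infinite.
\<close>

definition climb_pgf :: "real \<Rightarrow> real \<Rightarrow> real" where
  "climb_pgf x u = (1 - u) / (1 - x * u)"

lemma borel_measurable_climb_pgf [measurable]: "climb_pgf x \<in> borel_measurable borel"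
  unfolding climb_pgf_def[abs_def] by measurable

lemma one_minus_mult_pos:
  fixes x u :: real
  assumes "0 < x" "x < 1" "0 \<le> u" "u \<le> 1"
  shows "0 < 1 - x * u"
  using assms by (smt (verit) mult_left_le)

lemma climb_pgf_bounds:
  assumes "0 < x" "x < 1" "0 \<le> u" "u \<le> 1"
  shows "0 \<le> climb_pgf x u" and "climb_pgf x u \<le> 1"
  using one_minus_mult_pos[OF assms] assms mult_left_le_one_le[of u x]
  by (simp_all add: climb_pgf_def divide_le_eq)

text \<open>
  Conditioning on the next entry of the column: with probability \<open>u\<close> one more step is climbed,
  and otherwise the column is left.
\<close>

lemma climb_pgf_recursion:
  assumes "0 < x" "x < 1" "0 \<le> u" "u \<le> 1"
  shows "u * x * climb_pgf x u + (1 - u) = climb_pgf x u"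
  using one_minus_mult_pos[OF assms] by (simp add: climb_pgf_def field_simps)

lemma one_minus_climb_pgf:
  assumes "0 < x" "x < 1" "0 \<le> u" "u \<le> 1"
  shows "1 - climb_pgf x u = (1 - x) * (u / (1 - x * u))"
  using one_minus_mult_pos[OF assms] by (simp add: climb_pgf_def field_simps)

text \<open>
  For \<open>s \<le> 0\<close> both sides are 0 and for \<open>s \<ge> 1\<close> both are infinite, because truncation by
  \<^const>\<open>ennreal\<close> clips each of the two numbers \<open>s\<close> and \<open>1 - s\<close> at 0.
\<close>

lemma clip_odds: "ennreal s / ennreal (1 - s) = ennreal (clip s) / ennreal (1 - clip s)"
  by (cases "s < 0"; cases "1 < s") (auto simp: clip_def ennreal_neg)

text \<open>
  The damping parameter \<open>x = 1 - 1 / (k + 2)\<close> lies strictly between 0 and 1 and increases to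
  1. At \<open>u = 1\<close> the damped odds are \<open>k + 2\<close>, which tends to the infinite value of the
  undamped ones.
\<close>

lemma damped_odds_tendsto:
  fixes u :: real
  assumes "0 \<le> u" "u \<le> 1"
  shows "(\<lambda>k. ennreal (u / (1 - (1 - inverse (real (k + 2))) * u)))
           \<longlonglongrightarrow> ennreal u / ennreal (1 - u)"
proof -
  have lim: "filterlim (\<lambda>k. real (k + 2)) at_top sequentially"
    by (intro filterlim_compose[OF filterlim_real_sequentially] filterlim_add_const_nat_at_top)
  show ?thesis
  proof (cases "u = 1")
    case True
    from lim have "(\<lambda>k. ennreal (real (k + 2))) \<longlonglongrightarrow> top"
      by (simp only: ennreal_tendsto_top_eq_at_top)
    moreover have "u / (1 - (1 - inverse (real (k + 2))) * u) = real (k + 2)" for k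
      using True by (simp add: divide_inverse)
    ultimately show ?thesis
      using True by simp
  next
    case False
    from lim have "(\<lambda>k. inverse (real (k + 2))) \<longlonglongrightarrow> 0"
      by (rule tendsto_inverse_0_at_top)
    then have "(\<lambda>k. u / (1 - (1 - inverse (real (k + 2))) * u)) \<longlonglongrightarrow> u / (1 - (1 - 0) * u)"
      using False assms by (intro tendsto_intros) auto
    then show ?thesis
      using False assms by (auto simp: divide_ennreal intro!: tendsto_ennrealI)
  qed
qed

lemma nn_integral_damped_odds_tendsto:
  assumes [measurable]: "u \<in> borel_measurable D" and u: "\<And>s. 0 \<le> u s" "\<And>s. u s \<le> (1::real)"
  shows "(\<lambda>k. \<integral>\<^sup>+s. ennreal (u s / (1 - (1 - inverse (real (k + 2))) * u s)) \<partial>D)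
           \<longlonglongrightarrow> (\<integral>\<^sup>+s. ennreal (u s) / ennreal (1 - u s) \<partial>D)"
proof (rule nn_integral_LIMSEQ)
  show "incseq (\<lambda>k s. ennreal (u s / (1 - (1 - inverse (real (k + 2))) * u s)))"
  proof (intro incseq_SucI le_funI ennreal_leI divide_left_mono mult_pos_pos)
    fix k s
    show "1 - (1 - inverse (real (Suc k + 2))) * u s \<le> 1 - (1 - inverse (real (k + 2))) * u s"
      using u[of s] by (intro diff_left_mono mult_right_mono) (auto simp: field_simps)
    show "0 < 1 - (1 - inverse (real (Suc k + 2))) * u s" "0 < 1 - (1 - inverse (real (k + 2))) * u s"
      using u[of s] by (intro one_minus_mult_pos; simp add: field_simps)+
  qed (use u in auto)
  show "(\<lambda>k. ennreal (u s / (1 - (1 - inverse (real (k + 2))) * u s)))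
          \<longlonglongrightarrow> ennreal (u s) / ennreal (1 - u s)" for s
    using u by (rule damped_odds_tendsto)
qed measurable

lemma damped_odds_bounds:
  fixes x u :: real
  assumes "0 < x" "x < 1" "0 \<le> u" "u \<le> 1"
  shows "0 \<le> u / (1 - x * u)" and "u / (1 - x * u) \<le> 1 / (1 - x)"
  using one_minus_mult_pos[OF assms] assms mult_left_le[of u x]
  by (simp, intro frac_le) auto

lemma (in prob_space) integrable_damped_odds:
  assumes "0 < x" "x < 1" and [measurable]: "u \<in> borel_measurable M"
    and "\<And>s. 0 \<le> u s" "\<And>s. u s \<le> (1::real)"
  shows "integrable M (\<lambda>s. u s / (1 - x * u s))"
proof (rule integrable_const_bound[where B = "1 / (1 - x)"])
  show "AE s in M. norm (u s / (1 - x * u s)) \<le> 1 / (1 - x)"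
    using damped_odds_bounds[of x] assms by (intro AE_I2) (simp only: real_norm_def abs_of_nonneg)
qed measurable

lemma exists_damping_above_critical:
  assumes D: "prob_space D" and [measurable]: "u \<in> borel_measurable D"
    and u: "\<And>s. 0 \<le> u s" "\<And>s. u s \<le> (1::real)"
    and crit: "inverse (\<integral>\<^sup>+s. ennreal (u s) / ennreal (1 - u s) \<partial>D) < ennreal \<alpha>"
  shows "\<exists>x. 0 < x \<and> x < 1 \<and> 1 / \<alpha> < (\<integral>s. u s / (1 - x * u s) \<partial>D)"
proof -
  interpret D: prob_space D by (rule D)
  let ?I = "\<integral>\<^sup>+s. ennreal (u s) / ennreal (1 - u s) \<partial>D"
  have \<alpha>: "0 < \<alpha>"
    using crit by (metis ennreal_eq_0_iff leI not_less_zero)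
  have "ennreal (1 / \<alpha>) < ?I"
  proof (cases ?I)
    case (real r)
    have "r \<noteq> 0" using crit real by auto
    with real have "0 < r" by simp
    with crit real \<alpha> have "inverse r < \<alpha>"
      by (simp add: inverse_ennreal ennreal_less_iff)
    with \<open>0 < r\<close> \<alpha> show ?thesis
      unfolding real by (simp add: ennreal_less_iff field_simps)
  qed simp
  from order_tendstoD(1)[OF nn_integral_damped_odds_tendsto[of u D] this] u
  obtain k where k: "ennreal (1 / \<alpha>)
      < (\<integral>\<^sup>+s. ennreal (u s / (1 - (1 - inverse (real (k + 2))) * u s)) \<partial>D)"
    by (auto simp: eventually_sequentially)
  define x where "x = 1 - inverse (real (k + 2))"
  have x: "0 < x" "x < 1" by (auto simp: x_def field_simps)
  have "integrable D (\<lambda>s. u s / (1 - x * u s))"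
    by (intro D.integrable_damped_odds x u) measurable
  then have "(\<integral>\<^sup>+s. ennreal (u s / (1 - x * u s)) \<partial>D) = ennreal (\<integral>s. u s / (1 - x * u s) \<partial>D)"
    by (rule nn_integral_eq_integral) (use damped_odds_bounds[OF x u] in auto)
  with k \<alpha> x show ?thesis
    unfolding x_def[symmetric] by (auto simp: ennreal_less_iff)
qed

text \<open>
  Let \<open>\<beta>\<close> be the mean of the odds damped by some \<open>y < 1\<close> with \<open>\<alpha> \<beta> > 1\<close>. For every
  \<open>x \<ge> y\<close> the mean \<open>\<gamma>\<close> of the generating function is at most
  \<open>1 - (1 - x) \<beta> \<le> exp (- (1 - x) \<beta>)\<close>, so the quantity to be bounded decays at rate
  \<open>c = \<alpha> \<beta> (1 - x) + ln x\<close>. Since \<open>- ln x \<le> (1 - x) / x\<close>, this rate is positive once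
  \<open>\<alpha> \<beta> x > 1\<close>.
\<close>

lemma exists_exponential_chernoff_bound:
  assumes D: "prob_space D" and u_meas[measurable]: "u \<in> borel_measurable D"
    and u: "\<And>s. 0 \<le> u s" "\<And>s. u s \<le> (1::real)"
    and crit: "inverse (\<integral>\<^sup>+s. ennreal (u s) / ennreal (1 - u s) \<partial>D) < ennreal \<alpha>"
  shows "\<exists>x C c. 0 < x \<and> x < 1 \<and> 0 < c \<and>
    (\<forall>m. (1 / x) ^ m * (\<integral>s. climb_pgf x (u s) \<partial>D) ^ nat \<lfloor>\<alpha> * real m\<rfloor> \<le> C * exp (- c * real m))"
proof -
  interpret D: prob_space D by (rule D)
  have \<alpha>: "0 < \<alpha>"
    using crit by (metis ennreal_eq_0_iff leI not_less_zero)
  obtain y where y: "0 < y" "y < 1" and "1 / \<alpha> < (\<integral>s. u s / (1 - y * u s) \<partial>D)"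
    using exists_damping_above_critical[OF assms] by blast
  moreover define \<beta> where "\<beta> = (\<integral>s. u s / (1 - y * u s) \<partial>D)"
  ultimately have \<beta>: "1 < \<alpha> * \<beta>" using \<alpha> by (simp add: field_simps)
  then have "0 < \<beta>" using \<alpha> by (smt (verit) zero_less_mult_pos)
  \<comment> \<open>The midpoint of \<open>1 / (\<alpha> \<beta>)\<close> and 1 secures \<open>\<alpha> \<beta> x > 1\<close> while keeping \<open>x < 1\<close>.\<close>
  define x where "x = max y ((1 + 1 / (\<alpha> * \<beta>)) / 2)"
  have x: "0 < x" "x < 1" "y \<le> x" using y \<beta> by (auto simp: x_def field_simps)
  have "1 < \<alpha> * \<beta> * ((1 + 1 / (\<alpha> * \<beta>)) / 2)"
    using \<alpha> \<beta> \<open>0 < \<beta>\<close> by (simp add: field_simps)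
  also have "\<dots> \<le> \<alpha> * \<beta> * x" using \<beta> by (intro mult_left_mono) (auto simp: x_def)
  finally have \<beta>x: "1 < \<alpha> * \<beta> * x" .
  have int: "integrable D (\<lambda>s. u s / (1 - z * u s))" if "0 < z" "z < 1" for z
    by (intro D.integrable_damped_odds that u) measurable
  have int': "integrable D (\<lambda>s. climb_pgf x (u s))"
    by (rule D.integrable_const_bound[where B = 1]) (use climb_pgf_bounds[OF x(1,2) u] in auto)
  define \<gamma> where "\<gamma> = (\<integral>s. climb_pgf x (u s) \<partial>D)"
  have "\<beta> \<le> (\<integral>s. u s / (1 - x * u s) \<partial>D)"
    unfolding \<beta>_def using int x y u one_minus_mult_pos[OF x(1,2) u] one_minus_mult_pos[OF y u]
    by (intro integral_mono) (auto intro!: divide_left_mono mult_right_mono)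
  also have "(1 - x) * \<dots> = (\<integral>s. 1 - climb_pgf x (u s) \<partial>D)"
    using one_minus_climb_pgf[OF x(1,2) u] by (simp del: times_divide_eq_right)
  also have "\<dots> = 1 - \<gamma>"
    using int' by (simp add: \<gamma>_def D.prob_space)
  finally have "\<gamma> \<le> 1 - (1 - x) * \<beta>"
    using x by simp
  also have "\<dots> \<le> exp (- ((1 - x) * \<beta>))"
    using exp_ge_add_one_self[of "- ((1 - x) * \<beta>)"] by simp
  finally have \<gamma>: "\<gamma> \<le> exp (- ((1 - x) * \<beta>))" .
  have "0 \<le> \<gamma>"
    unfolding \<gamma>_def using climb_pgf_bounds[OF x(1,2) u] by simp
  define c where "c = \<alpha> * \<beta> * (1 - x) + ln x"
  have "ln (1 / x) \<le> 1 / x - 1" using x by (intro ln_le_minus_one) simp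
  also have "\<dots> = (1 - x) / x" using x by (simp add: field_simps)
  also have "\<dots> < \<alpha> * \<beta> * (1 - x)" 
    using x mult_strict_right_mono[OF \<beta>x, of "1 - x"] by (simp add: field_simps)
  finally have "0 < c" using x by (simp add: c_def ln_div)
  have "(1 / x) ^ m * \<gamma> ^ nat \<lfloor>\<alpha> * real m\<rfloor> \<le> exp ((1 - x) * \<beta>) * exp (- c * real m)" for m
  proof -
    \<comment> \<open>Rounding \<open>\<alpha> m\<close> down costs at most one column, hence the prefactor.\<close>
    define n where "n = nat \<lfloor>\<alpha> * real m\<rfloor>"
    have n: "\<alpha> * real m - 1 \<le> real n" unfolding n_def by linarith
    have "(1 / x) ^ m = exp (- ln x) ^ m"
      using x by (simp add: exp_minus inverse_eq_divide)
    also have "\<dots> = exp (- ln x * real m)"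
      by (simp add: exp_of_nat_mult[symmetric] mult.commute)
    finally have "(1 / x) ^ m * \<gamma> ^ n \<le> exp (- ln x * real m) * exp (- ((1 - x) * \<beta>)) ^ n"
      using \<gamma> \<open>0 \<le> \<gamma>\<close> by (simp add: power_mono)
    also have "\<dots> = exp (- ln x * real m - (1 - x) * \<beta> * real n)"
      by (simp add: exp_of_nat_mult[symmetric] exp_add[symmetric] mult_ac)
    also have "\<dots> \<le> exp (- ln x * real m - (1 - x) * \<beta> * (\<alpha> * real m - 1))"
      using x \<open>0 < \<beta>\<close> n by (auto intro!: mult_left_mono)
    also have "\<dots> = exp ((1 - x) * \<beta>) * exp (- c * real m)"
      by (simp add: exp_add[symmetric] c_def algebra_simps)
    finally show ?thesis unfolding n_def .
  qed
  then show ?thesis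
    using x \<open>0 < c\<close> unfolding \<gamma>_def by blast
qed

section \<open>The probability that the ascent gets stuck\<close>

context random_environment_matrix
begin

definition entries_match :: "(nat \<times> nat) set \<Rightarrow> (nat \<Rightarrow> nat \<Rightarrow> bool) \<Rightarrow> 'a \<Rightarrow> bool" where
  "entries_match S e \<omega> \<longleftrightarrow> (\<forall>(i, j)\<in>S. \<epsilon> i j \<omega> = e i j)"

definition match_weight :: "(nat \<times> nat) set \<Rightarrow> (nat \<Rightarrow> nat \<Rightarrow> bool) \<Rightarrow> 'a \<Rightarrow> real" where
  "match_weight S e \<omega> = (\<Prod>(i, j)\<in>S. if e i j then clip (p j \<omega>) else 1 - clip (p j \<omega>))"

lemma borel_measurable_environment: "1 \<le> j \<Longrightarrow> p j \<in> borel_measurable M"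
  using environment_indep by (auto simp: indep_vars_def)

lemma pred_entry: "1 \<le> i \<Longrightarrow> 1 \<le> j \<Longrightarrow> Measurable.pred M (\<epsilon> i j)"
  using entry_measurable by simp

lemma pred_entries_match:
  assumes "finite S" "S \<subseteq> {1..} \<times> {1..}"
  shows "Measurable.pred M (entries_match S e)"
proof -
  have [measurable]: "Measurable.pred M (\<epsilon> i j)" if "(i, j) \<in> S" for i j
    using assms that by (intro pred_entry) auto
  have "Measurable.pred M (\<lambda>\<omega>. \<forall>q\<in>S. \<epsilon> (fst q) (snd q) \<omega> = e (fst q) (snd q))"
    using assms(1) by measurable
  then show ?thesis
    by (simp add: entries_match_def[abs_def] case_prod_beta)
qed

lemma borel_measurable_match_weight:
  assumes "S \<subseteq> {1..} \<times> {1..}"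
  shows "match_weight S e \<in> borel_measurable M"
  unfolding match_weight_def[abs_def] case_prod_beta
proof (rule borel_measurable_prod)
  fix q assume "q \<in> S"
  with assms have [measurable]: "p (snd q) \<in> borel_measurable M"
    by (intro borel_measurable_environment) auto
  show "(\<lambda>\<omega>. if e (fst q) (snd q) then clip (p (snd q) \<omega>) else 1 - clip (p (snd q) \<omega>))
          \<in> borel_measurable M"
    by measurable
qed

lemma match_weight_bounds: "0 \<le> match_weight S e \<omega>" "match_weight S e \<omega> \<le> 1"
  unfolding match_weight_def by (auto intro!: prod_nonneg prod_le_1)

lemma match_weight_insert:
  assumes "finite S" "(i, j) \<notin> S"
  shows "match_weight (insert (i, j) S) (e(i := (e i)(j := b))) \<omega>
    = (if b then clip (p j \<omega>) else 1 - clip (p j \<omega>)) * match_weight S e \<omega>"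
proof -
  have "match_weight S (e(i := (e i)(j := b))) \<omega> = match_weight S e \<omega>"
    unfolding match_weight_def using assms(2) by (intro prod.cong) auto
  then show ?thesis
    using assms by (simp add: match_weight_def)
qed

lemma entries_match_insert:
  assumes "(i, j) \<notin> S"
  shows "entries_match (insert (i, j) S) (e(i := (e i)(j := b))) \<omega>
    \<longleftrightarrow> \<epsilon> i j \<omega> = b \<and> entries_match S e \<omega>"
proof -
  have "(e(i := (e i)(j := b))) i' j' = e i' j'" if "(i', j') \<in> S" for i' j'
    using that assms by auto
  then show ?thesis
    by (auto simp: entries_match_def)
qed

text \<open>
  Integrating the conditional law over the environment. The probability of getting stuck is
  estimated by splitting it into probabilities of such finite patterns.
\<close>

lemma prob_entries_match:
  assumes S: "finite S" "S \<subseteq> {1..} \<times> {1..}"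
  shows "prob {\<omega>\<in>space M. entries_match S e \<omega>} = (\<integral>\<omega>. match_weight S e \<omega> \<partial>M)"
proof -
  let ?N = "environment_algebra M p" and ?E = "{\<omega>\<in>space M. entries_match S e \<omega>}"
  have "(\<lambda>\<omega>. \<lambda>j\<in>{1..}. p j \<omega>) \<in> measurable M (\<Pi>\<^sub>M j\<in>{1..}. borel)"
    by (intro measurable_restrict borel_measurable_environment) auto
  note env = this
  then have "(\<lambda>\<omega>. \<lambda>j\<in>{1..}. p j \<omega>) \<in> space M \<rightarrow> space (\<Pi>\<^sub>M j\<in>{1..}. borel)"
    by (auto simp: measurable_def)
  with env have "subalgebra M ?N"
    unfolding subalgebra_def environment_algebra_def
    by (auto simp: sets_vimage_algebra2 intro: measurable_sets)
  then interpret N: finite_measure_subalgebra M ?N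
    by unfold_locales
  have E: "?E \<in> sets M"
    using pred_entries_match[OF S] by simp
  have "prob ?E = (\<integral>\<omega>. indicat_real ?E \<omega> \<partial>M)"
    using E by simp
  also have "\<dots> = (\<integral>\<omega>. real_cond_exp M ?N (indicat_real ?E) \<omega> \<partial>M)"
    by (intro N.real_cond_exp_int(2)[symmetric] integrable_real_indicator E)
      (simp add: less_top[symmetric])
  also have "\<dots> = (\<integral>\<omega>. match_weight S e \<omega> \<partial>M)"
  proof (rule integral_cong_AE)
    show "AE \<omega> in M. real_cond_exp M ?N (indicat_real ?E) \<omega> = match_weight S e \<omega>"
      using entry_conditional_law[OF S, of e]
      by (simp add: entries_match_def match_weight_def pmf_bernoulli_eq_clip)
  qed (use borel_measurable_match_weight[OF S(2)] in auto)
  finally show ?thesis .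
qed

lemma pred_ascends:
  assumes "r \<le> m" "1 \<le> j"
  shows "Measurable.pred M (\<lambda>\<omega>. ascends (\<lambda>i j. \<epsilon> i j \<omega>) m n r j)"
  using assms
proof (induction "m - r + (Suc n - j)" arbitrary: r j rule: less_induct)
  case less
  show ?case
  proof (cases "r = m \<or> n < j")
    case True
    then show ?thesis
      using less.prems by (cases "r = m") (simp_all add: ascends_top_row not_ascends_beyond_last_column)
  next
    case False
    then have rj: "r < m" "j \<le> n" using less.prems by auto
    have [measurable]: "Measurable.pred M (\<lambda>\<omega>. ascends (\<lambda>i j. \<epsilon> i j \<omega>) m n (Suc r) j)"
      "Measurable.pred M (\<lambda>\<omega>. ascends (\<lambda>i j. \<epsilon> i j \<omega>) m n r (Suc j))"
      "Measurable.pred M (\<epsilon> (Suc r) j)"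
      using less rj by (auto intro: pred_entry)
    have "(\<lambda>\<omega>. ascends (\<lambda>i j. \<epsilon> i j \<omega>) m n r j) =
      (\<lambda>\<omega>. if \<epsilon> (Suc r) j \<omega> then ascends (\<lambda>i j. \<epsilon> i j \<omega>) m n (Suc r) j
            else ascends (\<lambda>i j. \<epsilon> i j \<omega>) m n r (Suc j))"
      using rj less.prems by (simp add: fun_eq_iff ascends_step)
    then show ?thesis by simp
  qed
qed

text \<open>
  Prescribing the values of the entries inspected so far, at the positions in \<open>S\<close>, replaces
  conditioning on the past of the ascent: the induction then only needs the probabilities of
  finite patterns. The last hypothesis says that no position of \<open>S\<close> can still be inspected
  from \<open>(r, j)\<close>. Inspecting the entry at \<open>(r + 1, j)\<close> splits the event into two events of
  the same form, with factors \<open>clip (p j)\<close> and \<open>1 - clip (p j)\<close>, and the recursion of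
  \<^const>\<open>climb_pgf\<close> recombines the two bounds. When all columns are used up with \<open>r < m\<close>,
  the bound holds because \<open>1 / x > 1\<close>.
\<close>

lemma prob_match_and_stuck_le:
  assumes x: "0 < x" "x < 1"
    and "r \<le> m" "1 \<le> j" "finite S" "S \<subseteq> {1..} \<times> {1..}"
    and "\<forall>(i, k)\<in>S. i \<le> r \<or> k < j"
  shows "prob {\<omega>\<in>space M. entries_match S e \<omega> \<and> \<not> ascends (\<lambda>i j. \<epsilon> i j \<omega>) m n r j}
    \<le> (\<integral>\<omega>. match_weight S e \<omega> * (1 / x) ^ (m - r) * (\<Prod>k\<in>{j..n}. climb_pgf x (clip (p k \<omega>))) \<partial>M)"
    (is "?P S e r j \<le> ?B S e r j")
  using assms(3-)
proof (induction "m - r + (Suc n - j)" arbitrary: r j S e rule: less_induct)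
  case less
  note rj = less.prems(1,2) and S = less.prems(3,4) and fresh = less.prems(5)
  let ?g = "\<lambda>k \<omega>. climb_pgf x (clip (p k \<omega>))"
  have g: "0 \<le> climb_pgf x (clip s)" "climb_pgf x (clip s) \<le> 1" for s
    using climb_pgf_bounds[OF x] by auto
  have int: "integrable M (\<lambda>\<omega>. match_weight S e \<omega> * (1 / x) ^ (m - r) * (\<Prod>k\<in>{j..n}. ?g k \<omega>))"
    if "1 \<le> j" "S \<subseteq> {1..} \<times> {1..}" for S e r j
  proof -
    have [measurable]: "match_weight S e \<in> borel_measurable M"
      using that borel_measurable_match_weight by auto
    have [measurable]: "(\<lambda>\<omega>. \<Prod>k\<in>{j..n}. ?g k \<omega>) \<in> borel_measurable M"
      using that
      by (intro borel_measurable_prod measurable_compose[OF _ borel_measurable_climb_pgf]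
          measurable_compose[OF _ borel_measurable_clip] borel_measurable_environment) auto
    have "norm (match_weight S e \<omega> * (1 / x) ^ (m - r) * (\<Prod>k\<in>{j..n}. ?g k \<omega>)) \<le> 1 * (1 / x) ^ (m - r) * 1" for \<omega>
      unfolding norm_mult using x g match_weight_bounds[of S e \<omega>]
      by (intro mult_mono) (auto intro!: prod_nonneg prod_le_1 simp: abs_prod)
    then show ?thesis
      by (intro integrable_const_bound[where B = "1 * (1 / x) ^ (m - r) * 1"] AE_I2) simp_all
  qed
  consider "r = m" | "r < m" "n < j" | "r < m" "j \<le> n" using rj by linarith
  then show ?case
  proof cases
    case 1
    have "0 \<le> ?B S e r j"
      using x g match_weight_bounds(1)
      by (intro Bochner_Integration.integral_nonneg mult_nonneg_nonneg prod_nonneg) auto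
    then show ?thesis
      using 1 by (simp add: ascends_top_row)
  next
    case 2
    have "?P S e r j = (\<integral>\<omega>. match_weight S e \<omega> \<partial>M)"
      using 2 by (simp add: not_ascends_beyond_last_column prob_entries_match[OF S])
    also have "\<dots> = (\<integral>\<omega>. match_weight S e \<omega> * 1 \<partial>M)" by simp
    also have "\<dots> \<le> (\<integral>\<omega>. match_weight S e \<omega> * (1 / x) ^ (m - r) \<partial>M)"
    proof (intro integral_mono mult_left_mono)
      have "integrable M (match_weight S e)"
        using match_weight_bounds borel_measurable_match_weight[OF S(2)]
        by (intro integrable_const_bound[where B = 1]) auto
      then show "integrable M (\<lambda>\<omega>. match_weight S e \<omega> * 1)"
        "integrable M (\<lambda>\<omega>. match_weight S e \<omega> * (1 / x) ^ (m - r))"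
        by simp_all
    qed (use x match_weight_bounds in \<open>auto intro: one_le_power\<close>)
    also have "\<dots> = ?B S e r j"
      using 2 by simp
    finally show ?thesis .
  next
    case 3
    let ?q = "(Suc r, j)"
    let ?e = "\<lambda>b. e(Suc r := (e (Suc r))(j := b))"
    have new: "?q \<notin> S" using fresh by auto
    have S': "finite (insert ?q S)" "insert ?q S \<subseteq> {1..} \<times> {1..}"
      using S rj by auto
    have meas: "{\<omega>\<in>space M. entries_match (insert ?q S) e' \<omega> \<and> \<not> ascends (\<lambda>i j. \<epsilon> i j \<omega>) m n r' j'} \<in> sets M"
      if "r' \<le> m" "1 \<le> j'" for e' r' j'
    proof -
      note [measurable] = pred_entries_match[OF S'] pred_ascends[OF that]
      show ?thesis by measurable
    qed
    have "{\<omega>\<in>space M. entries_match S e \<omega> \<and> \<not> ascends (\<lambda>i j. \<epsilon> i j \<omega>) m n r j} =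
        {\<omega>\<in>space M. entries_match (insert ?q S) (?e True) \<omega> \<and> \<not> ascends (\<lambda>i j. \<epsilon> i j \<omega>) m n (Suc r) j} \<union>
        {\<omega>\<in>space M. entries_match (insert ?q S) (?e False) \<omega> \<and> \<not> ascends (\<lambda>i j. \<epsilon> i j \<omega>) m n r (Suc j)}"
      unfolding entries_match_insert[OF new]
      by (auto simp: ascends_step[OF \<open>r < m\<close> \<open>1 \<le> j\<close> \<open>j \<le> n\<close>])
    then have "?P S e r j \<le> ?P (insert ?q S) (?e True) (Suc r) j + ?P (insert ?q S) (?e False) r (Suc j)"
      using 3 rj by (simp only:) (intro measure_Un_le meas; simp)
    also have "\<dots> \<le> ?B (insert ?q S) (?e True) (Suc r) j + ?B (insert ?q S) (?e False) r (Suc j)"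
      using 3 rj S' fresh by (intro add_mono less.hyps) auto
    also have "\<dots> = (\<integral>\<omega>. match_weight (insert ?q S) (?e True) \<omega> * (1 / x) ^ (m - Suc r) * (\<Prod>k\<in>{j..n}. ?g k \<omega>)
        + match_weight (insert ?q S) (?e False) \<omega> * (1 / x) ^ (m - r) * (\<Prod>k\<in>{Suc j..n}. ?g k \<omega>) \<partial>M)"
      using rj S' by (intro Bochner_Integration.integral_add[symmetric] int) auto
    also have "\<dots> = ?B S e r j"
    proof (rule Bochner_Integration.integral_cong[OF refl])
      fix \<omega>
      let ?u = "clip (p j \<omega>)" and ?R = "\<Prod>k\<in>{Suc j..n}. ?g k \<omega>"
      let ?W = "match_weight S e \<omega>" and ?X = "(1 / x) ^ (m - r)"
      \<comment> \<open>Having climbed one row more costs one factor \<open>1 / x\<close> less.\<close>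
      have X: "(1 / x) ^ (m - Suc r) = x * ?X"
        using x 3 by (simp add: Suc_diff_Suc[symmetric])
      have "{j..n} = insert j {Suc j..n}" using 3 by auto
      then have R: "(\<Prod>k\<in>{j..n}. ?g k \<omega>) = climb_pgf x ?u * ?R" by simp
      have "match_weight (insert ?q S) (?e True) \<omega> * (1 / x) ^ (m - Suc r) * (\<Prod>k\<in>{j..n}. ?g k \<omega>)
          + match_weight (insert ?q S) (?e False) \<omega> * ?X * ?R
          = ?W * ?X * ?R * (?u * x * climb_pgf x ?u + (1 - ?u))"
        unfolding match_weight_insert[OF S(1) new] X R by (simp add: algebra_simps)
      also have "\<dots> = ?W * ?X * (\<Prod>k\<in>{j..n}. ?g k \<omega>)"
        using climb_pgf_recursion[OF x, of ?u] R by simp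
      finally show "match_weight (insert ?q S) (?e True) \<omega> * (1 / x) ^ (m - Suc r) * (\<Prod>k\<in>{j..n}. ?g k \<omega>)
          + match_weight (insert ?q S) (?e False) \<omega> * ?X * ?R
          = ?W * ?X * (\<Prod>k\<in>{j..n}. ?g k \<omega>)" .
    qed
    finally show ?thesis .
  qed
qed

lemma environment_law:
  assumes "unit_distribution_function F" "1 \<le> j"
  shows "distr M borel (p j) = interval_measure F"
proof (rule cdf_unique)
  have F: "mono F" "\<And>s. continuous (at_right s) F" "\<And>s. s < 0 \<Longrightarrow> F s = 0" "\<And>s. 1 \<le> s \<Longrightarrow> F s = 1"
    using assms(1) by (auto simp: unit_distribution_function_def)
  have bot: "(F \<longlongrightarrow> 0) at_bot"
    by (rule tendsto_eventually)
      (use F(3) in \<open>auto simp: eventually_at_bot_dense\<close>)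
  have top: "(F \<longlongrightarrow> 1) at_top"
    by (rule tendsto_eventually)
      (use F(4) in \<open>auto simp: eventually_at_top_linorder\<close>)
  show "real_distribution (interval_measure F)"
    by (intro real_distribution_interval_measure monoD[OF F(1)] F(2) bot top)
  show "real_distribution (distr M borel (p j))"
    using borel_measurable_environment[OF assms(2)] by (rule real_distribution_distr)
  show "cdf (distr M borel (p j)) = cdf (interval_measure F)"
    using environment_cdf[OF assms(2)] cdf_interval_measure[OF monoD[OF F(1)] F(2) bot] by simp
qed

text \<open>
  The ascent starts at row 0 and column 1 with nothing inspected. The product over the columns
  depends on the environment alone, so its expectation factorizes.
\<close>

lemma prob_stuck_le:
  assumes F: "unit_distribution_function F" and x: "0 < x" "x < 1"
  shows "prob {\<omega>\<in>space M. \<not> ascends (\<lambda>i j. \<epsilon> i j \<omega>) m n 0 1}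
    \<le> (1 / x) ^ m * (\<integral>s. climb_pgf x (clip s) \<partial>interval_measure F) ^ n"
proof -
  let ?g = "\<lambda>s. climb_pgf x (clip s)"
  have g: "0 \<le> ?g s" "?g s \<le> 1" for s
    using climb_pgf_bounds[OF x] by auto
  have indep: "indep_vars (\<lambda>_. borel) (\<lambda>k \<omega>. ?g (p k \<omega>)) {1..n}"
    by (rule indep_vars_compose2[where M' = "\<lambda>_. borel"])
      (auto intro: indep_vars_subset[OF environment_indep])
  have "integrable M (\<lambda>\<omega>. ?g (p k \<omega>))" if "k \<in> {1..n}" for k
  proof -
    have [measurable]: "p k \<in> borel_measurable M" 
      using that borel_measurable_environment by auto
    show ?thesis
      by (rule integrable_const_bound[where B = 1]) (use g in auto)
  qed
  then have "(\<integral>\<omega>. (\<Prod>k\<in>{1..n}. ?g (p k \<omega>)) \<partial>M) = (\<Prod>k\<in>{1..n}. \<integral>\<omega>. ?g (p k \<omega>) \<partial>M)"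
    by (intro indep_vars_lebesgue_integral indep) auto
  also have "\<dots> = (\<Prod>k\<in>{1..n}. \<integral>s. ?g s \<partial>interval_measure F)"
  proof (intro prod.cong refl)
    fix k assume "k \<in> {1..n}"
    then have k: "1 \<le> k" by simp
    show "(\<integral>\<omega>. ?g (p k \<omega>) \<partial>M) = (\<integral>s. ?g s \<partial>interval_measure F)"
      unfolding environment_law[OF F k, symmetric]
      by (rule integral_distr[symmetric, OF borel_measurable_environment[OF k]]) measurable
  qed
  finally have prod: "(\<integral>\<omega>. (\<Prod>k\<in>{1..n}. ?g (p k \<omega>)) \<partial>M) = (\<integral>s. ?g s \<partial>interval_measure F) ^ n"
    by simp
  show ?thesis
    using prob_match_and_stuck_le[OF x, of 0 m 1 "{}" undefined n]
    by (simp add: entries_match_def match_weight_def prod del: One_nat_def)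
qed

end

section \<open>Exponential convergence above the critical value\<close>

theorem proposition2p6:
  fixes M :: "'a measure" and F :: "real \<Rightarrow> real"
    and p :: "nat \<Rightarrow> 'a \<Rightarrow> real" and \<epsilon> :: "nat \<Rightarrow> nat \<Rightarrow> 'a \<Rightarrow> bool"
    and \<alpha> :: real and H :: "nat \<Rightarrow> 'a \<Rightarrow> nat"
  assumes "unit_distribution_function F"
    and "random_environment_matrix M F p \<epsilon>"
    and "right_edge F < 1"
    and "critical_value F < ennreal \<alpha>"
  defines "H \<equiv> \<lambda>m \<omega>. longest_increasing_path (\<lambda>i j. \<epsilon> i j \<omega>) m (nat \<lfloor>\<alpha> * real m\<rfloor>)"
  shows "(\<exists>C. \<exists>c>0. \<forall>m\<ge>1. \<bar>measure M {\<omega>\<in>space M. H m \<omega> = m} - 1\<bar> \<le> C * exp (- c * real m))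
    \<and> measure M {\<omega>\<in>space M. \<forall>\<^sub>F m in sequentially. H m \<omega> = m} = 1"
proof -
  interpret random_environment_matrix M F p \<epsilon> by (rule assms(2))
  define stuck where "stuck m = {\<omega>\<in>space M. H m \<omega> \<noteq> m}" for m
  have stuck_eq: "stuck m = {\<omega>\<in>space M. \<not> ascends (\<lambda>i j. \<epsilon> i j \<omega>) m (nat \<lfloor>\<alpha> * real m\<rfloor>) 0 1}" for m
    by (simp add: stuck_def H_def longest_increasing_path_eq_iff_ascends)
  have stuck_sets [measurable]: "stuck m \<in> sets M" for m
    unfolding stuck_eq by (intro predE pred_intros_logic pred_ascends) auto
  have "prob_space (interval_measure F)"
    using environment_law[OF assms(1), of 1] borel_measurable_environment[of 1]
    by (metis order_refl prob_space_distr)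
  moreover have "inverse (\<integral>\<^sup>+s. ennreal (clip s) / ennreal (1 - clip s) \<partial>interval_measure F) < ennreal \<alpha>"
    using assms(4) unfolding critical_value_def clip_odds[symmetric] .
  ultimately obtain x C c where x: "0 < x" "x < 1" and c: "0 < c"
    and decay: "\<And>m. (1 / x) ^ m * (\<integral>s. climb_pgf x (clip s) \<partial>interval_measure F) ^ nat \<lfloor>\<alpha> * real m\<rfloor>
      \<le> C * exp (- c * real m)"
    using exists_exponential_chernoff_bound[of "interval_measure F" clip \<alpha>] by auto
  have stuck_le: "prob (stuck m) \<le> C * exp (- c * real m)" for m
    unfolding stuck_eq using prob_stuck_le[OF assms(1) x] decay by (rule order_trans)
  have "\<bar>prob {\<omega>\<in>space M. H m \<omega> = m} - 1\<bar> \<le> C * exp (- c * real m)" for m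
  proof -
    have "{\<omega>\<in>space M. H m \<omega> = m} = space M - stuck m"
      by (auto simp: stuck_def)
    then show ?thesis
      using prob_compl[of "stuck m"] stuck_le[of m] by simp
  qed
  moreover have "prob {\<omega>\<in>space M. \<forall>\<^sub>F m in sequentially. H m \<omega> = m} = 1"
  proof -
    have "summable (\<lambda>m. C * exp (- c) ^ m)"
      using c by (intro summable_mult summable_geometric) simp
    then have "summable (\<lambda>m. C * exp (- c * real m))"
      by (simp add: exp_of_nat_mult[symmetric] mult.commute)
    then have "summable (\<lambda>m. prob (stuck m))"
      by (rule summable_comparison_test_ev[rotated]) (use stuck_le in simp)
    then have "AE \<omega> in M. \<forall>\<^sub>F m in sequentially. \<omega> \<in> space M - stuck m"
      by (intro borel_cantelli_AE1) (auto simp: emeasure_eq_measure)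
    then have "AE \<omega> in M. \<forall>\<^sub>F m in sequentially. H m \<omega> = m"
      by (rule AE_mp) (auto simp: stuck_def elim: eventually_mono)
    moreover have "{\<omega>\<in>space M. \<forall>\<^sub>F m in sequentially. H m \<omega> = m}
        = {\<omega>\<in>space M. \<forall>\<^sub>F m in sequentially. \<omega> \<notin> stuck m}"
      by (auto simp: stuck_def)
    moreover have "\<dots> \<in> sets M" 
      unfolding eventually_sequentially by measurable
    ultimately show ?thesis
      by (subst prob_eq_1) auto
  qed
  ultimately show ?thesis
    using c by blast
qed

end
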